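(* Let $s'>1$ be finite or countably infinite, and let $\Gamma$ be a grid of order $(s',1)$. Then there exist a thick infinite generalized quadrangle $\overline{A}$ and an epimorphism $\overline{\epsilon}:\overline{A}\to\Gamma$. (In particular, an epimorphism from an infinite thick generalized quadrangle onto a grid of order $(s',1)$ need not have $s'=1$, in contrast to the finite case.)
   Context: A point-line geometry is a weak generalized $4$-gon if any two elements (points or lines) lie in a common ordinary sub $4$-gon and there are no ordinary sub $k$-gons for $k=2,3$; it is a (thick) generalized quadrangle if moreover every point is on at least three lines and every line has at least three points. Order $(u,v)$ means that each line is incident with $u+1$ points and each point with $v+1$ lines ($u$, $v$ possibly infinite cardinals). A grid of order $(s',1)$ is a weak generalized $4$-gon of order $(s',1)$. A morphism maps points to points, lines to lines, and preserves incidence. An epimorphism is a morphism that is surjective on points and surjective on lines. *)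

theory Defs
  imports Main
begin

unbundle cardinal_syntax

record ('p, 'l) geometry =
  points :: "'p set"
  lines :: "'l set"
  incident :: "'p \<Rightarrow> 'l \<Rightarrow> bool"

definition point_line_geometry :: "('p, 'l) geometry \<Rightarrow> bool" where
  "point_line_geometry G \<longleftrightarrow>
     points G \<noteq> {} \<and> lines G \<noteq> {} \<and>
     (\<forall>p l. incident G p l \<longrightarrow> p \<in> points G \<and> l \<in> lines G)"

abbreviation points_on :: "('p, 'l) geometry \<Rightarrow> 'l \<Rightarrow> 'p set" where
  "points_on G l \<equiv> {p \<in> points G. incident G p l}"

abbreviation lines_through :: "('p, 'l) geometry \<Rightarrow> 'p \<Rightarrow> 'l set" where
  "lines_through G p \<equiv> {l \<in> lines G. incident G p l}"

definition elements :: "('p, 'l) geometry \<Rightarrow> ('p + 'l) set" where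
  "elements G = points G <+> lines G"

(* The vertices p 0, ..., p (k-1) and the sides l 0, ..., l (k-1) form a subgeometry (with the
   induced incidence) isomorphic to the ordinary k-gon: side l j joins p j and p (j+1 mod k). *)
definition ordinary_subgon ::
    "('p, 'l) geometry \<Rightarrow> nat \<Rightarrow> (nat \<Rightarrow> 'p) \<Rightarrow> (nat \<Rightarrow> 'l) \<Rightarrow> bool" where
  "ordinary_subgon G k p l \<longleftrightarrow>
     p ` {..<k} \<subseteq> points G \<and> l ` {..<k} \<subseteq> lines G \<and>
     inj_on p {..<k} \<and> inj_on l {..<k} \<and>
     (\<forall>i<k. \<forall>j<k. incident G (p i) (l j) \<longleftrightarrow> i = j \<or> i = (j + 1) mod k)"

definition subgon_elements :: "nat \<Rightarrow> (nat \<Rightarrow> 'p) \<Rightarrow> (nat \<Rightarrow> 'l) \<Rightarrow> ('p + 'l) set" where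
  "subgon_elements k p l = p ` {..<k} <+> l ` {..<k}"

definition weak_generalized_4gon :: "('p, 'l) geometry \<Rightarrow> bool" where
  "weak_generalized_4gon G \<longleftrightarrow>
     point_line_geometry G \<and>
     (\<forall>x \<in> elements G. \<forall>y \<in> elements G. \<exists>p l.
        ordinary_subgon G 4 p l \<and> x \<in> subgon_elements 4 p l \<and> y \<in> subgon_elements 4 p l) \<and>
     (\<forall>k \<in> {2, 3}. \<nexists>p l. ordinary_subgon G k p l)"

definition thick :: "('p, 'l) geometry \<Rightarrow> bool" where
  "thick G \<longleftrightarrow>
     (\<forall>p \<in> points G. \<exists>T \<subseteq> lines_through G p. card T = 3) \<and>
     (\<forall>l \<in> lines G. \<exists>T \<subseteq> points_on G l. card T = 3)"

definition generalized_quadrangle :: "('p, 'l) geometry \<Rightarrow> bool" where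
  "generalized_quadrangle G \<longleftrightarrow> weak_generalized_4gon G \<and> thick G"

definition infinite_geometry :: "('p, 'l) geometry \<Rightarrow> bool" where
  "infinite_geometry G \<longleftrightarrow> infinite (points G) \<and> infinite (lines G)"

(* u and v are cardinals, finite or infinite. *)
definition has_order :: "('p, 'l) geometry \<Rightarrow> 'u rel \<Rightarrow> 'v rel \<Rightarrow> bool" where
  "has_order G u v \<longleftrightarrow>
     (\<forall>l \<in> lines G. |points_on G l| =o u +c cone) \<and>
     (\<forall>p \<in> points G. |lines_through G p| =o v +c cone)"

definition grid :: "('p, 'l) geometry \<Rightarrow> 'u rel \<Rightarrow> bool" where
  "grid G s \<longleftrightarrow> weak_generalized_4gon G \<and> has_order G s cone"

definition morphism ::
    "('p, 'l) geometry \<Rightarrow> ('q, 'm) geometry \<Rightarrow> ('p \<Rightarrow> 'q) \<Rightarrow> ('l \<Rightarrow> 'm) \<Rightarrow> bool" where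
  "morphism G H f g \<longleftrightarrow>
     f ` points G \<subseteq> points H \<and> g ` lines G \<subseteq> lines H \<and>
     (\<forall>p \<in> points G. \<forall>l \<in> lines G. incident G p l \<longrightarrow> incident H (f p) (g l))"

definition epimorphism ::
    "('p, 'l) geometry \<Rightarrow> ('q, 'm) geometry \<Rightarrow> ('p \<Rightarrow> 'q) \<Rightarrow> ('l \<Rightarrow> 'm) \<Rightarrow> bool" where
  "epimorphism G H f g \<longleftrightarrow>
     morphism G H f g \<and> f ` points G = points H \<and> g ` lines G = lines H"

end

(* The quadrangle is a free completion. Starting from isolated points and lines, one repeatedly adds
   a new path p - m - q - l for every point p and line l that are not yet joined by such a path; this
   creates no digons or triangles. The base elements are mapped onto the countably many elements of
   the grid, and the map extends along every new path because in the grid, too, any point p and line l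
   admit m and q with p I m I q I l, even when p and l are incident (m = l, q = p). *)
theory Submission
  imports Defs "HOL-Library.Countable_Set_Type"
begin

text \<open>Surjectivity comes for free from the base: its points and lines carry no incidence among
  themselves, so they may be sent anywhere, in particular along an enumeration of the grid. Hence a
  single quadrangle, built without reference to the target, maps onto every countable grid, and the
  bound on \<open>s'\<close> enters as countability of the grid. The added paths have length three
  because this is the largest distance between a point and a line in a generalized quadrangle;
  projecting points onto lines, together with the absence of digons and triangles and a second
  element on every line and through every point, already yields the required ordinary 4-gons. The
  remark that \<open>s'\<close> need not be 1 calls for an actual grid of larger order; the grid on
  all pairs of naturals serves.\<close>

subsection \<open>Recognizing weak generalized quadrangles\<close>

text \<open>Projecting \<open>p2\<close> onto \<open>l3\<close> closes the path
  \<open>l3 - p0 - l0 - p1 - l1 - p2\<close> to a circuit of length eight. Any further incidence in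
  it would create a digon or a triangle, so the circuit is an ordinary 4-gon.\<close>

lemma four_gon_through_path:
  assumes digon: "\<And>p q l m. \<lbrakk>incident G p l; incident G q l; incident G p m; incident G q m\<rbrakk> \<Longrightarrow> p = q \<or> l = m"
    and triangle: "\<And>p q r a b c. \<lbrakk>incident G p a; incident G q a; incident G q b; incident G r b;
        incident G r c; incident G p c\<rbrakk> \<Longrightarrow> p = q \<or> q = r \<or> p = r \<or> a = b \<or> b = c \<or> a = c"
    and proj: "\<And>p l. \<lbrakk>p \<in> points G; l \<in> lines G\<rbrakk> \<Longrightarrow> \<exists>m q. incident G p m \<and> incident G q m \<and> incident G q l"
    and geom: "point_line_geometry G"
    and path: "incident G p0 l3" "incident G p0 l0" "incident G p1 l0" "incident G p1 l1" "incident G p2 l1"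
    and stretched: "l3 \<noteq> l0" "p0 \<noteq> p1" "l0 \<noteq> l1" "p1 \<noteq> p2"
  shows "\<exists>p l. ordinary_subgon G 4 p l \<and> {Inl p0, Inl p1, Inl p2, Inr l3, Inr l0, Inr l1} \<subseteq> subgon_elements 4 p l"
proof -
  have mem: "p \<in> points G \<and> l \<in> lines G" if "incident G p l" for p l
    using geom that unfolding point_line_geometry_def by blast
  obtain l2 p3 where new: "incident G p2 l2" "incident G p3 l2" "incident G p3 l3"
    using proj[of p2 l3] mem path by blast
  have a1: "\<not> incident G p1 l3" using digon path stretched by blast
  have a2: "\<not> incident G p0 l1" using digon path stretched by blast
  have a3: "\<not> incident G p2 l0" using digon path stretched by blast
  have a4: "\<not> incident G p2 l3" using triangle[of p0 l0 p1 l1 p2 l3] path stretched a1 a2 a3 by blast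
  have a5: "\<not> incident G p0 l2" using triangle[of p0 l0 p1 l1 p2 l2] path new stretched a1 a2 a3 by blast
  have a6: "\<not> incident G p3 l1" using triangle[of p0 l0 p1 l1 p3 l3] path new stretched a1 a2 a3 a4 a5 by blast
  have a7: "\<not> incident G p3 l0" using digon[of p0 l0 p3 l3] path new stretched a5 by blast
  have a8: "\<not> incident G p1 l2" using digon[of p1 l1 p2 l2] path new stretched a6 by blast
  let ?p = "\<lambda>i. [p0, p1, p2, p3] ! i" and ?l = "\<lambda>i. [l0, l1, l2, l3] ! i"
  have four: "{..<4} = {0, 1, 2, 3::nat}" by auto
  have all4: "(\<forall>i<4. R i) \<longleftrightarrow> R 0 \<and> R 1 \<and> R 2 \<and> R (3::nat)" for R
    by (auto simp: eval_nat_numeral All_less_Suc)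
  \<comment> \<open>Any two vertices, and any two sides, are told apart by one of the incidences or
    non-incidences above.\<close>
  have points_distinct: "distinct [p0, p1, p2, p3]"
    using path new a1 a2 a3 a4 a5 a6 a7 a8 stretched by auto
  have lines_distinct: "distinct [l0, l1, l2, l3]"
    using path new a1 a2 a3 a4 a5 a6 a7 a8 stretched by auto
  have "inj_on ?p {..<4}" "inj_on ?l {..<4}"
    using points_distinct lines_distinct by (auto simp: inj_on_def nth_eq_iff_index_eq)
  moreover have "?p ` {..<4} \<subseteq> points G" "?l ` {..<4} \<subseteq> lines G"
    unfolding four using path new mem by (simp_all add: numeral_eq_Suc)
  moreover have "\<forall>i<4. \<forall>j<4. incident G (?p i) (?l j) \<longleftrightarrow> i = j \<or> i = (j + 1) mod 4"
    unfolding all4 using path new a1 a2 a3 a4 a5 a6 a7 a8 by simp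
  ultimately have "ordinary_subgon G 4 ?p ?l"
    unfolding ordinary_subgon_def by blast
  moreover have "{Inl p0, Inl p1, Inl p2, Inr l3, Inr l0, Inr l1} \<subseteq> subgon_elements 4 ?p ?l"
    unfolding subgon_elements_def four by (auto simp: numeral_eq_Suc)
  ultimately show ?thesis by blast
qed

text \<open>Two elements at distance at most four in the incidence graph lie on a path without
  backtracking that can be extended, by \<open>other_point\<close> and \<open>other_line\<close>, to
  six elements starting with a line. The cases below are the possible distances and types of the two
  elements.\<close>

lemma weak_generalized_4gonI:
  assumes geom: "point_line_geometry G"
    and digon: "\<And>p q l m. \<lbrakk>incident G p l; incident G q l; incident G p m; incident G q m\<rbrakk> \<Longrightarrow> p = q \<or> l = m"
    and triangle: "\<And>p q r a b c. \<lbrakk>incident G p a; incident G q a; incident G q b; incident G r b;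
        incident G r c; incident G p c\<rbrakk> \<Longrightarrow> p = q \<or> q = r \<or> p = r \<or> a = b \<or> b = c \<or> a = c"
    and proj: "\<And>p l. \<lbrakk>p \<in> points G; l \<in> lines G\<rbrakk> \<Longrightarrow> \<exists>m q. incident G p m \<and> incident G q m \<and> incident G q l"
    and other_point: "\<And>p l. l \<in> lines G \<Longrightarrow> \<exists>q. incident G q l \<and> q \<noteq> p"
    and other_line: "\<And>p l. p \<in> points G \<Longrightarrow> \<exists>m. incident G p m \<and> m \<noteq> l"
  shows "weak_generalized_4gon G"
proof -
  have mem: "p \<in> points G" "l \<in> lines G" if "incident G p l" for p l
    using geom that unfolding point_line_geometry_def by blast+
  let ?W = "\<lambda>x y. \<exists>p l. ordinary_subgon G 4 p l \<and> x \<in> subgon_elements 4 p l \<and> y \<in> subgon_elements 4 p l"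
  have path: "?W x y"
    if "incident G p0 l3" "incident G p0 l0" "incident G p1 l0" "incident G p1 l1" "incident G p2 l1"
      "l3 \<noteq> l0" "p0 \<noteq> p1" "l0 \<noteq> l1" "p1 \<noteq> p2"
      "x \<in> {Inl p0, Inl p1, Inl p2, Inr l3, Inr l0, Inr l1}"
      "y \<in> {Inl p0, Inl p1, Inl p2, Inr l3, Inr l0, Inr l1}"
    for p0 p1 p2 l0 l1 l3 x y
    using four_gon_through_path[OF digon triangle proj geom that(1-9)] that(10,11) by blast
  have flag: "?W x y" if inc: "incident G p l" "x \<in> {Inl p, Inr l}" "y \<in> {Inl p, Inr l}" for p l x y
  proof -
    obtain l3 where l3: "incident G p l3" "l3 \<noteq> l" using other_line mem inc by blast
    obtain p1 where p1: "incident G p1 l" "p1 \<noteq> p" using other_point mem inc by blast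
    obtain l1 where l1: "incident G p1 l1" "l1 \<noteq> l" using other_line mem p1 by blast
    obtain p2 where p2: "incident G p2 l1" "p2 \<noteq> p1" using other_point mem l1 by blast
    show ?thesis using path[of p l3 l p1 l1 p2 x y] l3 p1 l1 p2 inc by blast
  qed
  have collinear: "?W (Inl p) (Inl q)" if inc: "incident G p l" "incident G q l" "p \<noteq> q" for p q l
  proof -
    obtain l3 where l3: "incident G p l3" "l3 \<noteq> l" using other_line mem inc by blast
    obtain l1 where l1: "incident G q l1" "l1 \<noteq> l" using other_line mem inc by blast
    obtain p2 where p2: "incident G p2 l1" "p2 \<noteq> q" using other_point mem l1 by blast
    show ?thesis using path[of p l3 l q l1 p2 "Inl p" "Inl q"] l3 l1 p2 inc by blast
  qed
  have concurrent: "?W (Inr l) (Inr m)" if inc: "incident G p l" "incident G p m" "l \<noteq> m" for p l m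
  proof -
    obtain p0 where p0: "incident G p0 l" "p0 \<noteq> p" using other_point mem inc by blast
    obtain l3 where l3: "incident G p0 l3" "l3 \<noteq> l" using other_line mem p0 by blast
    obtain p2 where p2: "incident G p2 m" "p2 \<noteq> p" using other_point mem inc by blast
    show ?thesis using path[of p0 l3 l p m p2 "Inr l" "Inr m"] l3 p0 p2 inc by blast
  qed
  have point_line: "?W (Inl p) (Inr l)" if pl: "p \<in> points G" "l \<in> lines G" for p l
  proof (cases "incident G p l")
    case True
    then show ?thesis using flag by blast
  next
    case False
    obtain m q where mq: "incident G p m" "incident G q m" "incident G q l" using proj pl by blast
    obtain l3 where l3: "incident G p l3" "l3 \<noteq> m" using other_line pl by blast
    obtain p2 where p2: "incident G p2 l" "p2 \<noteq> q" using other_point pl by blast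
    show ?thesis using path[of p l3 m q l p2 "Inl p" "Inr l"] mq l3 p2 False by blast
  qed
  have point_point: "?W (Inl p) (Inl q)" if pq: "p \<in> points G" "q \<in> points G" for p q
  proof -
    obtain l where l: "incident G q l" using other_line pq by blast
    show ?thesis
    proof (cases "\<exists>l. incident G p l \<and> incident G q l")
      case True
      then show ?thesis using flag[of p _ "Inl p" "Inl p"] collinear[of p _ q] by (cases "p = q") blast+
    next
      case False
      obtain m r where mr: "incident G p m" "incident G r m" "incident G r l" using proj pq l mem by blast
      obtain l3 where l3: "incident G p l3" "l3 \<noteq> m" using other_line pq by blast
      show ?thesis using path[of p l3 m r l q "Inl p" "Inl q"] mr l3 l False by blast
    qed
  qed
  have line_line: "?W (Inr l) (Inr m)" if lm: "l \<in> lines G" "m \<in> lines G" for l m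
  proof -
    obtain p where p: "incident G p l" using other_point lm by blast
    show ?thesis
    proof (cases "\<exists>p. incident G p l \<and> incident G p m")
      case True
      then show ?thesis using flag[of _ l "Inr l" "Inr l"] concurrent[of _ l m] by (cases "l = m") blast+
    next
      case False
      obtain n q where nq: "incident G p n" "incident G q n" "incident G q m" using proj lm p mem by blast
      obtain p2 where p2: "incident G p2 m" "p2 \<noteq> q" using other_point lm by blast
      show ?thesis using path[of p l n q m p2 "Inr l" "Inr m"] nq p2 p False by blast
    qed
  qed
  have "?W x y" if "x \<in> elements G" "y \<in> elements G" for x y
  proof -
    have sym: "?W y x \<Longrightarrow> ?W x y" by blast
    show ?thesis using that unfolding elements_def
      by (elim PlusE) (use point_point line_line point_line sym in blast)+
  qed
  moreover have "\<not> ordinary_subgon G 2 p l" for p l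
  proof
    assume "ordinary_subgon G 2 p l"
    then have inj: "inj_on p {..<2}" "inj_on l {..<2}"
      and inc: "\<And>i j. i < 2 \<Longrightarrow> j < 2 \<Longrightarrow> incident G (p i) (l j) \<longleftrightarrow> i = j \<or> i = (j + 1) mod 2"
      unfolding ordinary_subgon_def by blast+
    have "p 0 \<noteq> p 1" "l 0 \<noteq> l 1" using inj by (simp_all add: inj_on_eq_iff)
    moreover have "incident G (p 0) (l 0)" "incident G (p 0) (l 1)" "incident G (p 1) (l 0)" "incident G (p 1) (l 1)"
      using inc by auto
    ultimately show False using digon by blast
  qed
  moreover have "\<not> ordinary_subgon G 3 p l" for p l
  proof
    assume "ordinary_subgon G 3 p l"
    then have inj: "inj_on p {..<3}" "inj_on l {..<3}"
      and inc: "\<And>i j. i < 3 \<Longrightarrow> j < 3 \<Longrightarrow> incident G (p i) (l j) \<longleftrightarrow> i = j \<or> i = (j + 1) mod 3"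
      unfolding ordinary_subgon_def by blast+
    have "p 0 \<noteq> p 1" "p 1 \<noteq> p 2" "p 0 \<noteq> p 2" "l 0 \<noteq> l 1" "l 1 \<noteq> l 2" "l 0 \<noteq> l 2"
      using inj by (simp_all add: inj_on_eq_iff)
    moreover have "incident G (p 0) (l 0)" "incident G (p 1) (l 0)" "incident G (p 1) (l 1)"
      "incident G (p 2) (l 1)" "incident G (p 2) (l 2)" "incident G (p 0) (l 2)"
      using inc by auto
    ultimately show False using triangle by blast
  qed
  ultimately show ?thesis
    unfolding weak_generalized_4gon_def using geom by auto
qed

text \<open>A vertex and a side of an ordinary 4-gon are joined inside it by a path of length three,
  possibly degenerate; this is a finite check on indices.\<close>

lemma weak_generalized_4gon_projection:
  assumes "weak_generalized_4gon G" "p \<in> points G" "l \<in> lines G"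
  shows "\<exists>m q. incident G p m \<and> incident G q m \<and> incident G q l"
proof -
  obtain P L where ord: "ordinary_subgon G 4 P L" and "Inl p \<in> subgon_elements 4 P L" "Inr l \<in> subgon_elements 4 P L"
    using assms unfolding weak_generalized_4gon_def elements_def by blast
  then obtain i j where ij: "i < 4" "j < 4" "p = P i" "l = L j"
    unfolding subgon_elements_def by blast
  have inc: "incident G (P i) (L j) \<longleftrightarrow> i = j \<or> i = (j + 1) mod 4" if "i < 4" "j < 4" for i j
    using ord that unfolding ordinary_subgon_def by blast
  have four: "{..<4} = {0, 1, 2, 3::nat}" by auto
  have "i \<in> {..<4}" "j \<in> {..<4}" using ij by auto
  then have "\<exists>m\<in>{..<4}. \<exists>q\<in>{..<4}. (i = m \<or> i = (m + 1) mod 4) \<and>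
      (q = m \<or> q = (m + 1) mod 4) \<and> (q = j \<or> q = (j + 1) mod 4)"
    unfolding four by auto
  then show ?thesis using inc ij by (metis lessThan_iff)
qed

subsection \<open>The free completion\<close>

text \<open>A pair receives at most one path, being joined ever after, so the pair itself can name
  the two new elements. Terms also make the type countable and allow maps to be defined by
  recursion.\<close>

datatype free_point = Base_Point nat | Foot free_point free_line
  and free_line = Base_Line nat | Perp free_point free_line

instance free_point :: countable by countable_datatype
instance free_line :: countable by countable_datatype

text \<open>
  Incidence between terms, independent of the stage at which they appear: the terms
  \<open>Perp p l\<close> and \<open>Foot p l\<close> are the middle elements of a path from \<open>p\<close> to \<open>l\<close>.
  Terms occurring at no stage are junk.
\<close>
definition adj :: "free_point \<Rightarrow> free_line \<Rightarrow> bool" where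
  "adj x a \<longleftrightarrow> (\<exists>l. a = Perp x l) \<or> (\<exists>p. x = Foot p a) \<or> (\<exists>p l. x = Foot p l \<and> a = Perp p l)"

text \<open>Degenerate paths count: an incident pair is joined by \<open>m = l\<close> and
  \<open>q = p\<close>, so it never receives a new path.\<close>

definition joined :: "free_point set \<times> free_line set \<Rightarrow> free_point \<Rightarrow> free_line \<Rightarrow> bool" where
  "joined S p l \<longleftrightarrow> (\<exists>m\<in>snd S. \<exists>q\<in>fst S. adj p m \<and> adj q m \<and> adj q l)"

text \<open>
  The base elements with index \<open>Suc n\<close> enter isolated at stage \<open>Suc n\<close>. Hence every point
  present at stage \<open>k\<close> gets a new line \<open>Perp p (Base_Line k)\<close> one stage later, and dually,
  which makes the limit thick.
\<close>
primrec stage :: "nat \<Rightarrow> free_point set \<times> free_line set" where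
  "stage 0 = ({Base_Point 0}, {Base_Line 0})"
| "stage (Suc n) =
     (let N = {(p, l). p \<in> fst (stage n) \<and> l \<in> snd (stage n) \<and> \<not> joined (stage n) p l}
      in (insert (Base_Point (Suc n)) (fst (stage n) \<union> case_prod Foot ` N),
          insert (Base_Line (Suc n)) (snd (stage n) \<union> case_prod Perp ` N)))"

section \<open>Stages and the neighbours of new elements\<close>

abbreviation "stage_points n \<equiv> fst (stage n)"
abbreviation "stage_lines n \<equiv> snd (stage n)"

lemma stage_points_Suc:
  "x \<in> stage_points (Suc n) \<longleftrightarrow> x = Base_Point (Suc n) \<or> x \<in> stage_points n \<or>
     (\<exists>p\<in>stage_points n. \<exists>l\<in>stage_lines n. x = Foot p l \<and> \<not> joined (stage n) p l)"
  by (auto simp: Let_def)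

lemma stage_lines_Suc:
  "a \<in> stage_lines (Suc n) \<longleftrightarrow> a = Base_Line (Suc n) \<or> a \<in> stage_lines n \<or>
     (\<exists>p\<in>stage_points n. \<exists>l\<in>stage_lines n. a = Perp p l \<and> \<not> joined (stage n) p l)"
  by (auto simp: Let_def)

declare stage.simps(2) [simp del]

lemma stage_mono:
  assumes "m \<le> n"
  shows "stage_points m \<subseteq> stage_points n" "stage_lines m \<subseteq> stage_lines n"
  using assms by (induction rule: dec_induct) (auto simp: stage_points_Suc stage_lines_Suc)

lemma Base_Point_in_stage: "Base_Point i \<in> stage_points n \<longleftrightarrow> i \<le> n"
  by (induction n) (auto simp: stage_points_Suc le_Suc_eq)

lemma Base_Line_in_stage: "Base_Line i \<in> stage_lines n \<longleftrightarrow> i \<le> n"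
  by (induction n) (auto simp: stage_lines_Suc le_Suc_eq)

text \<open>Both middle elements of a path enter together; this carries newness from a point over to
  its line and back.\<close>

lemma Foot_in_stage_iff_Perp: "Foot p l \<in> stage_points n \<longleftrightarrow> Perp p l \<in> stage_lines n"
  by (induction n) (auto simp: stage_points_Suc stage_lines_Suc)

lemma Foot_in_stageE:
  assumes "Foot p l \<in> stage_points n"
  obtains m where "n = Suc m" "p \<in> stage_points m" "l \<in> stage_lines m"
proof -
  have "\<exists>m. n = Suc m \<and> p \<in> stage_points m \<and> l \<in> stage_lines m"
    using assms by (induction n) (auto simp: stage_points_Suc stage_lines_Suc)
  then show thesis using that by blast
qed

lemma Foot_in_Suc_stageD:
  assumes "Foot p l \<in> stage_points (Suc n)"
  shows "p \<in> stage_points n" "l \<in> stage_lines n"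
  using assms by (auto elim: Foot_in_stageE)

text \<open>A line \<open>Perp x l\<close> through the new point \<open>x\<close> would require
  \<open>x\<close> one stage earlier, and a new base point is isolated. Only the two neighbours
  inside the new path remain.\<close>

lemma new_point_cases:
  assumes "x \<in> stage_points (Suc n)" "x \<notin> stage_points n"
    and "a \<in> stage_lines (Suc n)" "adj x a"
  obtains p l where "x = Foot p l" "p \<in> stage_points n" "l \<in> stage_lines n" "\<not> joined (stage n) p l"
    "a = l \<or> a = Perp p l"
proof -
  have "a \<noteq> Perp x l" for l
    using assms Foot_in_Suc_stageD Foot_in_stage_iff_Perp by blast
  then show thesis
    using assms that unfolding stage_points_Suc adj_def by auto
qed

lemma new_line_cases:
  assumes "a \<in> stage_lines (Suc n)" "a \<notin> stage_lines n"
    and "x \<in> stage_points (Suc n)" "adj x a"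
  obtains p l where "a = Perp p l" "p \<in> stage_points n" "l \<in> stage_lines n" "\<not> joined (stage n) p l"
    "x = p \<or> x = Foot p l"
proof -
  have "x \<noteq> Foot p a" for p
    using assms Foot_in_Suc_stageD by blast
  then show thesis
    using assms that unfolding stage_lines_Suc adj_def by auto
qed

text \<open>
  An element that is new at a stage has at most two neighbours there. So a digon or triangle
  through a new element runs through the whole new path from some \<open>p\<close> to some \<open>l\<close>, and its
  remaining part joins \<open>p\<close> to \<open>l\<close> by a path that existed before.
\<close>
lemma stage_no_digon:
  assumes "p \<in> stage_points n" "q \<in> stage_points n" "l \<in> stage_lines n" "m \<in> stage_lines n"
    and "adj p l" "adj q l" "adj p m" "adj q m"
  shows "p = q \<or> l = m"
  using assms
proof (induction n arbitrary: p q l m)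
  case 0
  then show ?case by simp
next
  case (Suc n)
  have new_point: False
    if p: "p \<notin> stage_points n" "p \<noteq> q" "l \<noteq> m"
      "p \<in> stage_points (Suc n)" "q \<in> stage_points (Suc n)" "l \<in> stage_lines (Suc n)" "m \<in> stage_lines (Suc n)"
      "adj p l" "adj q l" "adj p m" "adj q m" for p q l m
  proof -
    obtain p' l' where x: "p = Foot p' l'" "p' \<in> stage_points n" "l' \<in> stage_lines n" "\<not> joined (stage n) p' l'"
        "l = l' \<or> l = Perp p' l'"
      using new_point_cases p by blast
    have "m = l' \<or> m = Perp p' l'"
      using new_point_cases[of p n m] p x by blast
    then have "adj q l'" "adj q (Perp p' l')" using x p by auto
    moreover have "Perp p' l' \<in> stage_lines (Suc n)" "Perp p' l' \<notin> stage_lines n"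
      using x(1) p Foot_in_stage_iff_Perp by auto
    ultimately have "q = p'"
      using new_line_cases[of "Perp p' l'" n q] p x by blast
    \<comment> \<open>Here \<open>p'\<close> is incident with \<open>l'\<close>, so the degenerate
      path joins them.\<close>
    then have "joined (stage n) p' l'"
      using x \<open>adj q l'\<close> unfolding joined_def by blast
    then show False using x by blast
  qed
  show ?case
  proof (rule ccontr)
    assume neq: "\<not> ?thesis"
    then have old: "p \<in> stage_points n" "q \<in> stage_points n"
      using new_point[of p q l m] new_point[of q p l m] Suc.prems by blast+
    \<comment> \<open>The only neighbours of a new line are \<open>p'\<close> and the equally new
      \<open>Foot p' l'\<close>, so it cannot carry two distinct old points.\<close>
    have old_line: "l \<in> stage_lines n" if l: "l \<in> stage_lines (Suc n)" "adj p l" "adj q l" for l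
    proof (rule ccontr)
      assume new: "l \<notin> stage_lines n"
      then obtain p' l' where x: "l = Perp p' l'" "p = p' \<or> p = Foot p' l'"
        using new_line_cases[of l n p] l Suc.prems by blast
      moreover have "q = p' \<or> q = Foot p' l'"
        using new_line_cases[of l n q] new l Suc.prems x by blast
      ultimately show False
        using new neq old Foot_in_stage_iff_Perp by blast
    qed
    then show False
      using Suc.IH[of p q l m] Suc.prems neq old by blast
  qed
qed

lemma stage_no_triangle:
  assumes "p \<in> stage_points n" "q \<in> stage_points n" "r \<in> stage_points n"
    and "a \<in> stage_lines n" "b \<in> stage_lines n" "c \<in> stage_lines n"
    and "adj p a" "adj q a" "adj q b" "adj r b" "adj r c" "adj p c"
  shows "p = q \<or> q = r \<or> p = r \<or> a = b \<or> b = c \<or> a = c"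
  using assms
proof (induction n arbitrary: p q r a b c)
  case 0
  then show ?case by simp
next
  case (Suc n)
  let ?P = "stage_points (Suc n)" and ?L = "stage_lines (Suc n)"
  \<comment> \<open>The new vertex \<open>p\<close> is the foot between the sides \<open>a\<close>
    and \<open>c\<close>. Then \<open>q = p'\<close>, and once \<open>r\<close> and \<open>b\<close>
    are known to be old, \<open>p' - b - r - l'\<close> is an old path joining a pair that was not
    joined.\<close>
  have half: False
    if t: "p = Foot p' l'" "\<not> joined (stage n) p' l'" "p' \<in> stage_points n" "l' \<in> stage_lines n"
      "a = Perp p' l'" "c = l'" "p \<notin> stage_points n"
      "p \<in> ?P" "q \<in> ?P" "r \<in> ?P" "a \<in> ?L" "b \<in> ?L" "c \<in> ?L"
      "adj p a" "adj q a" "adj q b" "adj r b" "adj r c" "adj p c"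
      "p \<noteq> q" "q \<noteq> r" "p \<noteq> r" "a \<noteq> b" "b \<noteq> c" "a \<noteq> c" for p q r a b c p' l'
  proof -
    have "a \<notin> stage_lines n" using t Foot_in_stage_iff_Perp by auto
    then have q: "q = p'" using new_line_cases[of a n q] t by blast
    \<comment> \<open>A new \<open>r\<close> would lie on \<open>c = l2\<close> and
      \<open>b = Perp p2 l2\<close>. Since \<open>q = p'\<close> is on \<open>b\<close>, this gives
      \<open>p2 = p'\<close>, hence \<open>b = a\<close>.\<close>
    have r: "r \<in> stage_points n"
    proof (rule ccontr)
      assume new: "r \<notin> stage_points n"
      then obtain p2 l2 where x: "r = Foot p2 l2" "p2 \<in> stage_points n" "b = l2 \<or> b = Perp p2 l2"
        using new_point_cases[of r n b] t by blast
      have "c = l2 \<or> c = Perp p2 l2" using new_point_cases[of r n c] new t x by blast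
      then have "c = l2" "b = Perp p2 l2" using x t new Foot_in_stage_iff_Perp by blast+
      moreover have "b \<notin> stage_lines n" using calculation x new Foot_in_stage_iff_Perp by blast
      then have "q = p2 \<or> q = r" using new_line_cases[of b n q] calculation x t by blast
      ultimately show False using q t by blast
    qed
    have "b \<in> stage_lines n"
    proof (rule ccontr)
      assume new: "b \<notin> stage_lines n"
      then obtain p2 l2 where x: "b = Perp p2 l2" "q = p2 \<or> q = Foot p2 l2"
        using new_line_cases[of b n q] t by blast
      have "r = p2 \<or> r = Foot p2 l2" using new_line_cases[of b n r] new t x by blast
      then show False using x r q t new Foot_in_stage_iff_Perp by blast
    qed
    then have "joined (stage n) p' l'" unfolding joined_def using r q t by blast
    then show False using t by blast
  qed
  have new_point: "p \<in> stage_points n"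
    if t: "p \<in> ?P" "q \<in> ?P" "r \<in> ?P" "a \<in> ?L" "b \<in> ?L" "c \<in> ?L"
      "adj p a" "adj q a" "adj q b" "adj r b" "adj r c" "adj p c"
      "p \<noteq> q" "q \<noteq> r" "p \<noteq> r" "a \<noteq> b" "b \<noteq> c" "a \<noteq> c" for p q r a b c
  proof (rule ccontr)
    assume new: "p \<notin> stage_points n"
    then obtain p' l' where x: "p = Foot p' l'" "p' \<in> stage_points n" "l' \<in> stage_lines n" "\<not> joined (stage n) p' l'"
        "a = l' \<or> a = Perp p' l'"
      using new_point_cases[of p n a] t by blast
    moreover have "c = l' \<or> c = Perp p' l'" using new_point_cases[of p n c] new t x by blast
    ultimately consider "a = Perp p' l'" "c = l'" | "c = Perp p' l'" "a = l'" using t by blast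
    then show False
    proof cases
      case 1
      show False by (rule half[of p p' l' a c q r b]) (use 1 t x new in auto)
    next
      case 2
      show False by (rule half[of p p' l' c a r q b]) (use 2 t x new in auto)
    qed
  qed
  show ?case
  proof (rule ccontr)
    assume neq: "\<not> ?thesis"
    \<comment> \<open>\<open>new_point\<close> is applied to the three rotations and reflections of
      the triangle that put each vertex first.\<close>
    have old: "p \<in> stage_points n" "q \<in> stage_points n" "r \<in> stage_points n"
      using new_point[of p q r a b c] new_point[of q r p b c a] new_point[of r p q c a b] Suc.prems neq by blast+
    have old_line: "l \<in> stage_lines n"
      if l: "l \<in> ?L" "adj x l" "adj y l" "x \<noteq> y" "x \<in> stage_points n" "y \<in> stage_points n" for l x y
    proof (rule ccontr)
      assume new: "l \<notin> stage_lines n"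
      have xy: "x \<in> ?P" "y \<in> ?P" using l stage_points_Suc by blast+
      obtain p' l' where z: "l = Perp p' l'" "x = p' \<or> x = Foot p' l'"
        using new_line_cases[of l n x] new l xy by blast
      moreover have "y = p' \<or> y = Foot p' l'"
        using new_line_cases[of l n y] new l xy z by blast
      ultimately show False
        using new l Foot_in_stage_iff_Perp by blast
    qed
    have "a \<in> stage_lines n" "b \<in> stage_lines n" "c \<in> stage_lines n"
      using old_line[of a p q] old_line[of b q r] old_line[of c p r] old Suc.prems neq by blast+
    then show False
      using Suc.IH[of p q r a b c] Suc.prems neq old by blast
  qed
qed

section \<open>The limit of the stages\<close>

definition free_points :: "free_point set" where "free_points = (\<Union>n. stage_points n)"
definition free_lines :: "free_line set" where "free_lines = (\<Union>n. stage_lines n)"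

lemma free_points_common_stage:
  assumes "finite X" "X \<subseteq> free_points" "finite Y" "Y \<subseteq> free_lines"
  obtains n where "X \<subseteq> stage_points n" "Y \<subseteq> stage_lines n"
proof -
  have "\<exists>n. X \<subseteq> stage_points n"
    using assms(1,2)
  proof (induction X)
    case (insert x X)
    then obtain m n where "X \<subseteq> stage_points m" "x \<in> stage_points n" unfolding free_points_def by auto
    then have "insert x X \<subseteq> stage_points (max m n)"
      using stage_mono(1)[of m "max m n"] stage_mono(1)[of n "max m n"] by auto
    then show ?case by blast
  qed simp
  moreover have "\<exists>n. Y \<subseteq> stage_lines n"
    using assms(3,4)
  proof (induction Y)
    case (insert x X)
    then obtain m n where "X \<subseteq> stage_lines m" "x \<in> stage_lines n" unfolding free_lines_def by auto
    then have "insert x X \<subseteq> stage_lines (max m n)"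
      using stage_mono(2)[of m "max m n"] stage_mono(2)[of n "max m n"] by auto
    then show ?case by blast
  qed simp
  ultimately obtain m n where "X \<subseteq> stage_points m" "Y \<subseteq> stage_lines n" by blast
  then have "X \<subseteq> stage_points (max m n)" "Y \<subseteq> stage_lines (max m n)"
    using stage_mono(1)[of m "max m n"] stage_mono(2)[of n "max m n"] by auto
  then show thesis using that by blast
qed

lemma free_no_digon:
  assumes "p \<in> free_points" "q \<in> free_points" "l \<in> free_lines" "m \<in> free_lines"
    and "adj p l" "adj q l" "adj p m" "adj q m"
  shows "p = q \<or> l = m"
proof -
  obtain n where "{p, q} \<subseteq> stage_points n" "{l, m} \<subseteq> stage_lines n"
    using free_points_common_stage[of "{p, q}" "{l, m}"] assms by auto
  then show ?thesis using stage_no_digon[of p n q l m] assms by auto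
qed

lemma free_no_triangle:
  assumes "p \<in> free_points" "q \<in> free_points" "r \<in> free_points"
    and "a \<in> free_lines" "b \<in> free_lines" "c \<in> free_lines"
    and "adj p a" "adj q a" "adj q b" "adj r b" "adj r c" "adj p c"
  shows "p = q \<or> q = r \<or> p = r \<or> a = b \<or> b = c \<or> a = c"
proof -
  obtain n where "{p, q, r} \<subseteq> stage_points n" "{a, b, c} \<subseteq> stage_lines n"
    using free_points_common_stage[of "{p, q, r}" "{a, b, c}"] assms by auto
  then show ?thesis using stage_no_triangle[of p n q r a b c] assms by auto
qed

lemma adj_Perp: "adj p (Perp p l)" and adj_Foot: "adj (Foot p l) l" and adj_Foot_Perp: "adj (Foot p l) (Perp p l)"
  unfolding adj_def by auto

lemma free_projection:
  assumes "p \<in> free_points" "l \<in> free_lines"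
  shows "\<exists>m\<in>free_lines. \<exists>q\<in>free_points. adj p m \<and> adj q m \<and> adj q l"
proof -
  obtain n where n: "p \<in> stage_points n" "l \<in> stage_lines n"
    using free_points_common_stage[of "{p}" "{l}"] assms by auto
  show ?thesis
  proof (cases "joined (stage n) p l")
    case True
    then show ?thesis unfolding joined_def free_points_def free_lines_def by blast
  next
    case False
    then have "Foot p l \<in> stage_points (Suc n)" "Perp p l \<in> stage_lines (Suc n)"
      using n unfolding stage_points_Suc stage_lines_Suc by auto
    then show ?thesis
      using adj_Perp adj_Foot adj_Foot_Perp unfolding free_points_def free_lines_def by blast
  qed
qed

text \<open>At its entry the base line is isolated: a point on it would be a foot on it, and a foot
  needs its line one stage earlier.\<close>

lemma not_joined_new_Base_Line: "\<not> joined (stage n) p (Base_Line n)"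
proof
  assume "joined (stage n) p (Base_Line n)"
  then obtain q where q: "q \<in> stage_points n" "adj q (Base_Line n)" unfolding joined_def by blast
  then obtain p' where "q = Foot p' (Base_Line n)" unfolding adj_def by auto
  then show False using q by (auto elim!: Foot_in_stageE simp: Base_Line_in_stage)
qed

text \<open>A line through the base point would be some \<open>Perp (Base_Point n) l'\<close>; its
  foot enters with it and needs the base point one stage earlier.\<close>

lemma not_joined_new_Base_Point: "\<not> joined (stage n) (Base_Point n) l"
proof
  assume "joined (stage n) (Base_Point n) l"
  then obtain m where m: "m \<in> stage_lines n" "adj (Base_Point n) m" unfolding joined_def by blast
  then obtain l' where "Foot (Base_Point n) l' \<in> stage_points n" unfolding adj_def
    using Foot_in_stage_iff_Perp by auto
  then show False by (auto elim!: Foot_in_stageE simp: Base_Point_in_stage)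
qed

lemma free_three_lines:
  assumes "p \<in> free_points"
  shows "\<exists>T \<subseteq> free_lines. card T = 3 \<and> (\<forall>l\<in>T. adj p l)"
proof -
  obtain n where n: "p \<in> stage_points n" using assms unfolding free_points_def by blast
  have "Perp p (Base_Line k) \<in> free_lines" if "n \<le> k" for k
  proof -
    have "Perp p (Base_Line k) \<in> stage_lines (Suc k)"
      using n stage_mono(1)[OF that] not_joined_new_Base_Line unfolding stage_lines_Suc by (auto simp: Base_Line_in_stage)
    then show ?thesis unfolding free_lines_def by blast
  qed
  then show ?thesis
    by (intro exI[of _ "{Perp p (Base_Line n), Perp p (Base_Line (n + 1)), Perp p (Base_Line (n + 2))}"])
      (auto simp: adj_Perp)
qed

lemma free_three_points:
  assumes "l \<in> free_lines"
  shows "\<exists>T \<subseteq> free_points. card T = 3 \<and> (\<forall>p\<in>T. adj p l)"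
proof -
  obtain n where n: "l \<in> stage_lines n" using assms unfolding free_lines_def by blast
  have "Foot (Base_Point k) l \<in> free_points" if "n \<le> k" for k
  proof -
    have "Foot (Base_Point k) l \<in> stage_points (Suc k)"
      using n stage_mono(2)[OF that] not_joined_new_Base_Point unfolding stage_points_Suc by (auto simp: Base_Point_in_stage)
    then show ?thesis unfolding free_points_def by blast
  qed
  then show ?thesis
    by (intro exI[of _ "{Foot (Base_Point n) l, Foot (Base_Point (n + 1)) l, Foot (Base_Point (n + 2)) l}"])
      (auto simp: adj_Foot)
qed

text \<open>Terms are coded as naturals. Incidence demands membership in the limit, since otherwise
  junk terms would be incident without belonging to the geometry.\<close>

definition free_quadrangle :: "(nat, nat) geometry" where
  "free_quadrangle = \<lparr>points = to_nat ` free_points, lines = to_nat ` free_lines,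
     incident = \<lambda>x a. \<exists>p\<in>free_points. \<exists>l\<in>free_lines. x = to_nat p \<and> a = to_nat l \<and> adj p l\<rparr>"

lemma incident_free_quadrangle:
  "incident free_quadrangle (to_nat p) (to_nat l) \<longleftrightarrow> p \<in> free_points \<and> l \<in> free_lines \<and> adj p l"
  unfolding free_quadrangle_def by auto

lemma incident_free_quadrangleD:
  assumes "incident free_quadrangle x a"
  shows "from_nat x \<in> free_points" "from_nat a \<in> free_lines" "adj (from_nat x) (from_nat a)"
    "to_nat (from_nat x :: free_point) = x" "to_nat (from_nat a :: free_line) = a"
  using assms unfolding free_quadrangle_def by auto

lemma Base_Point_free: "Base_Point n \<in> free_points"
  using Base_Point_in_stage unfolding free_points_def by blast

lemma Base_Line_free: "Base_Line n \<in> free_lines"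
  using Base_Line_in_stage unfolding free_lines_def by blast

lemma infinite_free_quadrangle: "infinite_geometry free_quadrangle"
proof -
  have "infinite (range Base_Point)" "infinite (range Base_Line)"
    by (auto intro!: range_inj_infinite injI)
  moreover have "range Base_Point \<subseteq> free_points" "range Base_Line \<subseteq> free_lines"
    using Base_Point_free Base_Line_free by auto
  ultimately have "infinite free_points" "infinite free_lines"
    using finite_subset by blast+
  then show ?thesis
    unfolding infinite_geometry_def free_quadrangle_def by (simp add: finite_image_iff)
qed

lemma thick_free_quadrangle: "thick free_quadrangle"
  unfolding thick_def
proof (intro conjI ballI)
  fix x assume "x \<in> points free_quadrangle"
  then obtain p where p: "x = to_nat p" "p \<in> free_points" unfolding free_quadrangle_def by auto
  obtain T where "T \<subseteq> free_lines" "card T = 3" "\<forall>l\<in>T. adj p l" using free_three_lines p by blast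
  then have "to_nat ` T \<subseteq> lines_through free_quadrangle x" "card (to_nat ` T) = 3"
    unfolding p(1) using p(2) by (auto simp: incident_free_quadrangle card_image) (auto simp: free_quadrangle_def)
  then show "\<exists>T\<subseteq>lines_through free_quadrangle x. card T = 3" by blast
next
  fix a assume "a \<in> lines free_quadrangle"
  then obtain l where l: "a = to_nat l" "l \<in> free_lines" unfolding free_quadrangle_def by auto
  obtain T where "T \<subseteq> free_points" "card T = 3" "\<forall>p\<in>T. adj p l" using free_three_points l by blast
  then have "to_nat ` T \<subseteq> points_on free_quadrangle a" "card (to_nat ` T) = 3"
    unfolding l(1) using l(2) by (auto simp: incident_free_quadrangle card_image) (auto simp: free_quadrangle_def)
  then show "\<exists>T\<subseteq>points_on free_quadrangle a. card T = 3" by blast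
qed

lemma generalized_quadrangle_free_quadrangle: "generalized_quadrangle free_quadrangle"
  unfolding generalized_quadrangle_def
proof
  have three: "\<exists>x\<in>T. x \<noteq> y" if "card T = 3" for T :: "nat set" and y
  proof (rule ccontr)
    assume "\<not> ?thesis"
    then have "T \<subseteq> {y}" by auto
    from card_mono[OF _ this] show False using that by simp
  qed
  show "weak_generalized_4gon free_quadrangle"
  proof (rule weak_generalized_4gonI)
    show "point_line_geometry free_quadrangle"
      using Base_Point_free Base_Line_free unfolding point_line_geometry_def free_quadrangle_def by auto
    show "p = q \<or> l = m" if h: "incident free_quadrangle p l" "incident free_quadrangle q l"
      "incident free_quadrangle p m" "incident free_quadrangle q m" for p q l m
    proof -
      note D = h[THEN incident_free_quadrangleD(1)] h[THEN incident_free_quadrangleD(2)]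
        h[THEN incident_free_quadrangleD(3)]
      have "(from_nat p :: free_point) = from_nat q \<or> (from_nat l :: free_line) = from_nat m"
        by (rule free_no_digon) (fact D)+
      then show ?thesis
        using h[THEN incident_free_quadrangleD(4)] h[THEN incident_free_quadrangleD(5)] by metis
    qed
    show "p = q \<or> q = r \<or> p = r \<or> a = b \<or> b = c \<or> a = c"
      if h: "incident free_quadrangle p a" "incident free_quadrangle q a" "incident free_quadrangle q b"
        "incident free_quadrangle r b" "incident free_quadrangle r c" "incident free_quadrangle p c" for p q r a b c
    proof -
      note D = h[THEN incident_free_quadrangleD(1)] h[THEN incident_free_quadrangleD(2)]
        h[THEN incident_free_quadrangleD(3)]
      have "(from_nat p :: free_point) = from_nat q \<or> (from_nat q :: free_point) = from_nat r \<or>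
          (from_nat p :: free_point) = from_nat r \<or> (from_nat a :: free_line) = from_nat b \<or>
          (from_nat b :: free_line) = from_nat c \<or> (from_nat a :: free_line) = from_nat c"
        by (rule free_no_triangle) (fact D)+
      then show ?thesis
        using h[THEN incident_free_quadrangleD(4)] h[THEN incident_free_quadrangleD(5)] by metis
    qed
    show "\<exists>m q. incident free_quadrangle p m \<and> incident free_quadrangle q m \<and> incident free_quadrangle q l"
      if "p \<in> points free_quadrangle" "l \<in> lines free_quadrangle" for p l
    proof -
      obtain p' l' where pl: "p = to_nat p'" "p' \<in> free_points" "l = to_nat l'" "l' \<in> free_lines"
        using \<open>p \<in> points free_quadrangle\<close> \<open>l \<in> lines free_quadrangle\<close> unfolding free_quadrangle_def by auto
      then obtain m q where "m \<in> free_lines" "q \<in> free_points" "adj p' m" "adj q m" "adj q l'"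
        using free_projection by blast
      then have "incident free_quadrangle p (to_nat m)" "incident free_quadrangle (to_nat q) (to_nat m)"
          "incident free_quadrangle (to_nat q) l"
        using pl by (simp_all add: incident_free_quadrangle)
      then show ?thesis by blast
    qed
    show "\<exists>q. incident free_quadrangle q l \<and> q \<noteq> p" if l: "l \<in> lines free_quadrangle" for p l
    proof -
      obtain T where "T \<subseteq> points_on free_quadrangle l" "card T = 3"
        using thick_free_quadrangle l unfolding thick_def by blast
      then show ?thesis using three[of T p] by auto
    qed
    show "\<exists>m. incident free_quadrangle p m \<and> m \<noteq> l" if p: "p \<in> points free_quadrangle" for p l
    proof -
      obtain T where "T \<subseteq> lines_through free_quadrangle p" "card T = 3"
        using thick_free_quadrangle p unfolding thick_def by blast
      then show ?thesis using three[of T l] by auto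
    qed
  qed
qed (rule thick_free_quadrangle)

subsection \<open>Epimorphisms onto grids\<close>

text \<open>The extension of arbitrary base assignments \<open>e\<close> and \<open>d\<close>;
  \<open>u\<close> and \<open>v\<close> are to choose the middle point and middle line of a path in
  the target. Junk terms receive values as well.\<close>

primrec hom_point :: "(nat \<Rightarrow> 'p) \<Rightarrow> (nat \<Rightarrow> 'l) \<Rightarrow> ('p \<Rightarrow> 'l \<Rightarrow> 'p) \<Rightarrow> ('p \<Rightarrow> 'l \<Rightarrow> 'l) \<Rightarrow> free_point \<Rightarrow> 'p"
  and hom_line :: "(nat \<Rightarrow> 'p) \<Rightarrow> (nat \<Rightarrow> 'l) \<Rightarrow> ('p \<Rightarrow> 'l \<Rightarrow> 'p) \<Rightarrow> ('p \<Rightarrow> 'l \<Rightarrow> 'l) \<Rightarrow> free_line \<Rightarrow> 'l"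
  where
    "hom_point e d u v (Base_Point n) = e n"
  | "hom_point e d u v (Foot p l) = u (hom_point e d u v p) (hom_line e d u v l)"
  | "hom_line e d u v (Base_Line n) = d n"
  | "hom_line e d u v (Perp p l) = v (hom_point e d u v p) (hom_line e d u v l)"

lemma epimorphism_from_free_quadrangle:
  assumes G: "weak_generalized_4gon G" and countable: "countable (points G)" "countable (lines G)"
  shows "\<exists>f g. epimorphism free_quadrangle G f g"
proof -
  have nonempty: "points G \<noteq> {}" "lines G \<noteq> {}"
    and mem: "\<And>p l. incident G p l \<Longrightarrow> p \<in> points G \<and> l \<in> lines G"
    using G unfolding weak_generalized_4gon_def point_line_geometry_def by blast+
  \<comment> \<open>The enumeration repeats elements if the set is finite, so all base elements get
    an image in either case.\<close>
  define e d where "e = from_nat_into (points G)" and "d = from_nat_into (lines G)"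
  have e: "range e = points G" and d: "range d = lines G"
    unfolding e_def d_def using nonempty countable by (simp_all add: range_from_nat_into)
  define w where "w = (\<lambda>p l. SOME (q, m). incident G p m \<and> incident G q m \<and> incident G q l)"
  define u v where "u = (\<lambda>p l. fst (w p l))" and "v = (\<lambda>p l. snd (w p l))"
  have uv: "incident G p (v p l)" "incident G (u p l) (v p l)" "incident G (u p l) l"
    if pl: "p \<in> points G" "l \<in> lines G" for p l
  proof -
    obtain m q where "incident G p m \<and> incident G q m \<and> incident G q l"
      using weak_generalized_4gon_projection[OF G pl] by blast
    then have "case (q, m) of (q, m) \<Rightarrow> incident G p m \<and> incident G q m \<and> incident G q l"
      by simp
    then have "case w p l of (q, m) \<Rightarrow> incident G p m \<and> incident G q m \<and> incident G q l"
      unfolding w_def by (rule someI)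
    then show "incident G p (v p l)" "incident G (u p l) (v p l)" "incident G (u p l) l"
      unfolding u_def v_def by (simp_all add: case_prod_unfold)
  qed
  let ?f = "hom_point e d u v" and ?g = "hom_line e d u v"
  have fg: "?f p \<in> points G" "?g l \<in> lines G" for p l
  proof (induction p and l)
    case (Foot p l)
    then show ?case using mem[of "u (?f p) (?g l)" "?g l"] uv[of "?f p" "?g l"] by simp
  next
    case (Perp p l)
    then show ?case using mem[of "?f p" "v (?f p) (?g l)"] uv[of "?f p" "?g l"] by simp
  qed (use e d in \<open>simp_all, blast+\<close>)
  \<comment> \<open>The three disjuncts of \<open>adj\<close> are the three incidences of an added
    path, and \<open>uv\<close> provides them in the target. No stage is involved, as
    \<open>fg\<close> holds for all terms.\<close>
  have inc: "incident G (?f p) (?g l)" if "adj p l" for p l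
    using that unfolding adj_def by (elim disjE exE conjE) (simp_all add: uv fg)
  have "?f ` free_points = points G"
  proof
    show "points G \<subseteq> ?f ` free_points"
    proof
      fix p assume "p \<in> points G"
      then have "p \<in> range e" using e by simp
      then obtain n where "p = ?f (Base_Point n)" by auto
      then show "p \<in> ?f ` free_points" using Base_Point_free by blast
    qed
  qed (use fg in blast)
  moreover have "?g ` free_lines = lines G"
  proof
    show "lines G \<subseteq> ?g ` free_lines"
    proof
      fix l assume "l \<in> lines G"
      then have "l \<in> range d" using d by simp
      then obtain n where "l = ?g (Base_Line n)" by auto
      then show "l \<in> ?g ` free_lines" using Base_Line_free by blast
    qed
  qed (use fg in blast)
  moreover have "(?f \<circ> from_nat) ` points free_quadrangle = ?f ` free_points"
      "(?g \<circ> from_nat) ` lines free_quadrangle = ?g ` free_lines"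
    unfolding free_quadrangle_def by (simp_all add: image_image)
  moreover have "incident G ((?f \<circ> from_nat) x) ((?g \<circ> from_nat) a)" if "incident free_quadrangle x a" for x a
    using inc[OF incident_free_quadrangleD(3)[OF that]] by simp
  ultimately have "epimorphism free_quadrangle G (?f \<circ> from_nat) (?g \<circ> from_nat)"
    unfolding epimorphism_def morphism_def by simp
  then show ?thesis by blast
qed

section \<open>Countability of grids\<close>

lemma cone_less_natLeq: "cone <o natLeq"
  by (rule Cfinite_ordLess_Cinfinite[OF Cfinite_cone natLeq_Cinfinite])

lemma countable_if_card_csum_cone:
  assumes "|X| =o r +c cone" "r \<le>o natLeq" "Card_order r"
  shows "countable X"
proof -
  have "r +c cone \<le>o natLeq"
    using assms ordLess_imp_ordLeq[OF cone_less_natLeq]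
    by (intro csum_cinfinite_bound natLeq_Cinfinite Card_order_cone)
  then show ?thesis
    using assms(1) ordIso_ordLeq_trans countable_card_le_natLeq by blast
qed

text \<open>From a fixed point \<open>p\<close> every line \<open>l\<close> is reached along
  \<open>p - m - q - l\<close>, with countably many choices at each step. The points are then
  covered by countably many lines.\<close>

lemma countable_weak_generalized_4gon:
  assumes G: "weak_generalized_4gon G"
    and on: "\<And>l. l \<in> lines G \<Longrightarrow> countable (points_on G l)"
    and through: "\<And>p. p \<in> points G \<Longrightarrow> countable (lines_through G p)"
  shows "countable (points G)" "countable (lines G)"
proof -
  have nonempty: "points G \<noteq> {}" "lines G \<noteq> {}"
    and mem: "\<And>p l. incident G p l \<Longrightarrow> p \<in> points G \<and> l \<in> lines G"
    using G unfolding weak_generalized_4gon_def point_line_geometry_def by blast+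
  obtain p where p: "p \<in> points G" using nonempty by blast
  let ?L = "\<Union>q \<in> (\<Union>m \<in> lines_through G p. points_on G m). lines_through G q"
  have "lines G \<subseteq> ?L"
  proof
    fix l assume "l \<in> lines G"
    then obtain m q where "incident G p m" "incident G q m" "incident G q l"
      using weak_generalized_4gon_projection[OF G p] by blast
    then show "l \<in> ?L" using mem by auto
  qed
  moreover have "countable ?L"
  proof (rule countable_UN)
    show "countable (\<Union>m\<in>lines_through G p. points_on G m)"
      by (rule countable_UN[OF through[OF p]]) (rule on, blast)
  qed (rule through, blast)
  ultimately show lines: "countable (lines G)" by (rule countable_subset)
  obtain l where l: "l \<in> lines G" using nonempty by blast
  have "points G \<subseteq> (\<Union>m \<in> lines G. points_on G m)"
  proof
    fix q assume "q \<in> points G"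
    then obtain m where "incident G q m"
      using weak_generalized_4gon_projection[OF G _ l] by blast
    then show "q \<in> (\<Union>m \<in> lines G. points_on G m)" using mem by auto
  qed
  moreover have "countable (\<Union>m \<in> lines G. points_on G m)"
    by (rule countable_UN[OF lines on])
  ultimately show "countable (points G)" by (rule countable_subset)
qed

lemma epimorphism_onto_grid:
  assumes "Card_order s" "s \<le>o natLeq" "grid G s"
  shows "\<exists>f g. epimorphism free_quadrangle G f g"
proof -
  have G: "weak_generalized_4gon G" "has_order G s cone"
    using assms(3) unfolding grid_def by blast+
  have on: "countable (points_on G l)" if "l \<in> lines G" for l
    by (rule countable_if_card_csum_cone[OF _ assms(2,1)]) (use G(2) that in \<open>simp add: has_order_def\<close>)
  have through: "countable (lines_through G p)" if "p \<in> points G" for p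
    by (rule countable_if_card_csum_cone[OF _ ordLess_imp_ordLeq[OF cone_less_natLeq] Card_order_cone])
      (use G(2) that in \<open>simp add: has_order_def\<close>)
  show ?thesis
    using epimorphism_from_free_quadrangle[OF G(1)] countable_weak_generalized_4gon[OF G(1) on through] by blast
qed

section \<open>A grid of infinite order\<close>

text \<open>The points code pairs \<open>(i, j)\<close>; line \<open>2 * k\<close> is
  \<open>i = k\<close> and line \<open>2 * k + 1\<close> is \<open>j = k\<close>, so parity gives
  the parallel class.\<close>

definition nat_grid :: "(nat, nat) geometry" where
  "nat_grid = \<lparr>points = UNIV, lines = UNIV, incident = \<lambda>p l.
     if even l then fst (prod_decode p) = l div 2 else snd (prod_decode p) = l div 2\<rparr>"

lemma incident_nat_grid:
  "incident nat_grid (prod_encode (i, j)) (2 * k) \<longleftrightarrow> i = k"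
  "incident nat_grid (prod_encode (i, j)) (Suc (2 * k)) \<longleftrightarrow> j = k"
  unfolding nat_grid_def by auto

lemma nat_grid_line_cases:
  fixes l :: nat
  obtains k where "l = 2 * k" | k where "l = Suc (2 * k)"
  by (metis evenE oddE Suc_eq_plus1)

lemma nat_grid_point_cases:
  fixes p :: nat
  obtains i j where "p = prod_encode (i, j)"
  by (metis prod_decode_inverse surj_pair)

lemma nat_grid_lines_through: "{l. incident nat_grid (prod_encode (i, j)) l} = {2 * i, Suc (2 * j)}"
proof (intro set_eqI iffI)
  fix l assume "l \<in> {l. incident nat_grid (prod_encode (i, j)) l}"
  then show "l \<in> {2 * i, Suc (2 * j)}"
    by (cases l rule: nat_grid_line_cases) (auto simp: incident_nat_grid)
qed (auto simp: incident_nat_grid)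

lemma grid_nat_grid: "grid nat_grid natLeq"
proof -
  have univ: "points nat_grid = UNIV" "lines nat_grid = UNIV"
    by (simp_all add: nat_grid_def)
  have lines: "incident nat_grid (prod_encode (i, j)) l \<longleftrightarrow> l = 2 * i \<or> l = Suc (2 * j)" for i j l
    using nat_grid_lines_through by auto
  have parallel: "l = m" if "incident nat_grid p l" "incident nat_grid p m" "even l \<longleftrightarrow> even m" for p l m
    using that by (cases p rule: nat_grid_point_cases) (auto simp: lines)
  have parity: "2 * i \<noteq> Suc (2 * j)" for i j :: nat
    by presburger
  have infinite: "infinite {p. incident nat_grid p l}" for l
  proof (cases l rule: nat_grid_line_cases)
    case (1 k)
    then have "range (\<lambda>j. prod_encode (k, j)) \<subseteq> {p. incident nat_grid p l}"
      by (auto simp: incident_nat_grid)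
    moreover have "infinite (range (\<lambda>j. prod_encode (k, j)))"
      by (intro range_inj_infinite injI) simp
    ultimately show ?thesis using finite_subset by blast
  next
    case (2 k)
    then have "range (\<lambda>i. prod_encode (i, k)) \<subseteq> {p. incident nat_grid p l}"
      by (auto simp: incident_nat_grid)
    moreover have "infinite (range (\<lambda>i. prod_encode (i, k)))"
      by (intro range_inj_infinite injI) simp
    ultimately show ?thesis using finite_subset by blast
  qed
  have "weak_generalized_4gon nat_grid"
  proof (rule weak_generalized_4gonI)
    show "point_line_geometry nat_grid"
      unfolding point_line_geometry_def univ by simp
    show "p = q \<or> l = m" if h: "incident nat_grid p l" "incident nat_grid q l"
      "incident nat_grid p m" "incident nat_grid q m" for p q l m
    proof -
      obtain i j i' j' where pq: "p = prod_encode (i, j)" "q = prod_encode (i', j')"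
        using nat_grid_point_cases by metis
      show ?thesis
        using h parity[of i j] parity[of i j'] parity[of i' j] parity[of i' j'] unfolding pq lines by auto
    qed
    show "p = q \<or> q = r \<or> p = r \<or> a = b \<or> b = c \<or> a = c"
      if "incident nat_grid p a" "incident nat_grid q a" "incident nat_grid q b"
        "incident nat_grid r b" "incident nat_grid r c" "incident nat_grid p c" for p q r a b c
    proof -
      \<comment> \<open>Among three lines two have equal parity; they meet in a vertex of the
        triangle, hence coincide by \<open>parallel\<close>.\<close>
      have "even a \<and> even b \<or> even b \<and> even c \<or> even a \<and> even c \<or>
            odd a \<and> odd b \<or> odd b \<and> odd c \<or> odd a \<and> odd c"
        by blast
      then show ?thesis
        using that parallel by blast
    qed
    show "\<exists>m q. incident nat_grid p m \<and> incident nat_grid q m \<and> incident nat_grid q l" for p l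
    proof (cases p rule: nat_grid_point_cases)
      case p: (1 i j)
      show ?thesis
      proof (cases l rule: nat_grid_line_cases)
        case (1 k)
        then have "incident nat_grid (prod_encode (k, j)) (Suc (2 * j))" "incident nat_grid (prod_encode (k, j)) l"
          "incident nat_grid p (Suc (2 * j))"
          using p by (simp_all add: incident_nat_grid)
        then show ?thesis by blast
      next
        case (2 k)
        then have "incident nat_grid (prod_encode (i, k)) (2 * i)" "incident nat_grid (prod_encode (i, k)) l"
          "incident nat_grid p (2 * i)"
          using p by (simp_all add: incident_nat_grid)
        then show ?thesis by blast
      qed
    qed
    show "\<exists>q. incident nat_grid q l \<and> q \<noteq> p" for p l
    proof -
      have "infinite ({q. incident nat_grid q l} - {p})" using infinite by simp
      then show ?thesis using infinite_imp_nonempty by blast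
    qed
    show "\<exists>m. incident nat_grid p m \<and> m \<noteq> l" for p l
      by (cases p rule: nat_grid_point_cases) (use parity lines in metis)
  qed
  moreover have "|points_on nat_grid l| =o natLeq +c cone" for l
  proof -
    have "|points_on nat_grid l| =o natLeq"
    proof (unfold ordIso_iff_ordLeq, intro conjI)
      show "|points_on nat_grid l| \<le>o natLeq"
        by (rule countable_card_le_natLeq[THEN iffD1]) simp
      show "natLeq \<le>o |points_on nat_grid l|"
        using infinite_iff_natLeq_ordLeq[of "points_on nat_grid l"] infinite[of l] by (simp add: univ)
    qed
    also have "natLeq =o natLeq +c cone"
      by (rule ordIso_symmetric[OF csum_absorb1[OF natLeq_Cinfinite ordLess_imp_ordLeq[OF cone_less_natLeq]]])
    finally show ?thesis .
  qed
  moreover have "|lines_through nat_grid p| =o cone +c cone" for p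
  proof (cases p rule: nat_grid_point_cases)
    case (1 i j)
    then have "lines_through nat_grid p = {2 * i, Suc (2 * j)}"
      using nat_grid_lines_through univ by simp
    \<comment> \<open>\<open>{()} <+> {()}\<close> is the two-element set underlying
      \<open>cone +c cone\<close>, so a bijection from the two lines is enough.\<close>
    then have "card (lines_through nat_grid p) = card ({()} <+> {()})" "finite (lines_through nat_grid p)"
      using parity[of i j] by (simp_all add: card_Plus)
    then have "\<exists>h. bij_betw h (lines_through nat_grid p) ({()} <+> {()})"
      by (intro finite_same_card_bij) simp_all
    then show ?thesis
      unfolding csum_def cone_def Field_card_of by (rule card_of_ordIso[THEN iffD1])
  qed
  ultimately show ?thesis
    unfolding grid_def has_order_def by blast
qed

theorem mainTheorem4:
  "(\<forall>(s' :: 'c rel) (\<Gamma> :: ('p, 'l) geometry).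
      Card_order s' \<and> cone <o s' \<and> s' \<le>o natLeq \<and> grid \<Gamma> s' \<longrightarrow>
      (\<exists>(A :: (nat, nat) geometry) f g.
         generalized_quadrangle A \<and> infinite_geometry A \<and> epimorphism A \<Gamma> f g)) \<and>
   (\<exists>(s' :: nat rel) (\<Gamma> :: (nat, nat) geometry) (A :: (nat, nat) geometry) f g.
      Card_order s' \<and> grid \<Gamma> s' \<and> generalized_quadrangle A \<and> infinite_geometry A \<and>
      epimorphism A \<Gamma> f g \<and> \<not> s' =o cone)"
proof (intro conjI allI impI)
  fix s' :: "'c rel" and \<Gamma> :: "('p, 'l) geometry"
  assume "Card_order s' \<and> cone <o s' \<and> s' \<le>o natLeq \<and> grid \<Gamma> s'"
  then obtain f g where "epimorphism free_quadrangle \<Gamma> f g"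
    using epimorphism_onto_grid by blast
  then show "\<exists>(A :: (nat, nat) geometry) f g.
      generalized_quadrangle A \<and> infinite_geometry A \<and> epimorphism A \<Gamma> f g"
    using generalized_quadrangle_free_quadrangle infinite_free_quadrangle by blast
next
  \<comment> \<open>The second claim is witnessed by \<open>s' = natLeq\<close> and
    \<open>nat_grid\<close>; an infinite cardinal is not \<open>cone\<close>.\<close>
  have "natLeq \<le>o natLeq"
    by (rule ordLeq_reflexive[OF natLeq_Well_order])
  then obtain f g where "epimorphism free_quadrangle nat_grid f g"
    using epimorphism_onto_grid[OF natLeq_Card_order _ grid_nat_grid] by blast
  moreover have "\<not> natLeq =o cone"
    using not_ordLess_ordIso[OF cone_less_natLeq] ordIso_symmetric by blast
  ultimately show "\<exists>(s' :: nat rel) (\<Gamma> :: (nat, nat) geometry) (A :: (nat, nat) geometry) f g.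
      Card_order s' \<and> grid \<Gamma> s' \<and> generalized_quadrangle A \<and> infinite_geometry A \<and>
      epimorphism A \<Gamma> f g \<and> \<not> s' =o cone"
    using natLeq_Card_order grid_nat_grid generalized_quadrangle_free_quadrangle infinite_free_quadrangle by blast
qed

end
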